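(* Let $\mathcal{M}$ be a Kripke model and let $\phi$ be a closed CTL$_P(\mathcal{M})$ formula. Then the sequent $\vdash \phi$ (with empty left-hand side) has a proof in the proof system SCTL$(\mathcal{M})$ if and only if $\mathcal{M}\models\phi$.
   Context: A Kripke model $\mathcal{M}$ consists of a finite non-empty set $S$ of states, a binary relation $\longrightarrow$ on $S$ such that every $s\in S$ has at least one $s'$ with $s\longrightarrow s'$, and a family of relations $P\subseteq S^n$ (various $n$). Write $\mathsf{Next}(s)=\{s'\mid s\longrightarrow s'\}$. A path is a finite or infinite sequence of states with each element followed by an element of $\mathsf{Next}$ of it. CTL$_P(\mathcal{M})$ formulas: there is a constant for each state and a predicate symbol for each relation of $\mathcal{M}$; terms $t,t_i$ are constants or variables; formulas are $\top\mid\bot\mid P(t_1,\dots,t_n)\mid\neg P(t_1,\dots,t_n)\mid\phi\wedge\phi\mid\phi\vee\phi\mid AX_x(\phi)(t)\mid EX_x(\phi)(t)\mid AF_x(\phi)(t)\mid EG_x(\phi)(t)\mid AR_{x,y}(\phi_1,\phi_2)(t)\mid EU_{x,y}(\phi_1,\phi_2)(t)$, where $AX,EX,AF,EG$ bind $x$ in $\phi$, and $AR,EU$ bind $x$ in $\phi_1$ and $y$ in $\phi_2$. $(t/x)\phi$ denotes capture-avoiding substitution. Validity of a closed formula: $\mathcal{M}\models P(s_1,\dots,s_n)$ iff $\langle s_1,\dots,s_n\rangle\in P$; $\mathcal{M}\models\neg P(\bar s)$ iff $\langle\bar s\rangle\notin P$; $\top$ always valid, $\bot$ never; $\wedge,\vee$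 as usual; $AX_x(\phi)(s)$ iff $(s'/x)\phi$ is valid for all $s'\in\mathsf{Next}(s)$; $EX_x(\phi)(s)$ iff it is valid for some $s'\in\mathsf{Next}(s)$; $AF_x(\phi)(s)$ iff there is a finite tree with root labeled $s$, in which the children of each internal node labeled $s'$ are labeled by the elements of $\mathsf{Next}(s')$, and $(s'/x)\phi$ is valid for each leaf label $s'$; $EG_x(\phi)(s)$ iff there is an infinite path $s_0=s,s_1,\dots$ with $(s_i/x)\phi$ valid for all $i$; $AR_{x,y}(\phi_1,\phi_2)(s)$ iff there is a possibly infinite tree with root $s$, children of each internal node $s'$ labeled by the elements of $\mathsf{Next}(s')$, with $(s'/y)\phi_2$ valid at every node $s'$ and $(s'/x)\phi_1$ valid at every leaf $s'$; $EU_{x,y}(\phi_1,\phi_2)(s)$ iff there is a finite path $s_0=s,\dots,s_n$ with $(s_n/y)\phi_2$ valid and $(s_i/x)\phi_1$ valid for all $i<n$. SCTL$(\mathcal{M})$: sequents have the form $\Gamma\vdash\phi$ with $\Gamma$ a finite set of formulas; a proof is a finite derivation tree using the rules (empty left-hand side written $\vdash$): atom-R: $\vdash P(s_1,\dots,s_n)$ if $\langle \bar s\rangle\in P$; $\neg$-R: $\vdash\neg P(\bar s)$ if $\langle\bar s\rangle\notin P$; $\top$-R: $\vdash\top$; $\wedge$-R: from $\vdash\phi_1$ and $\vdash\phi_2$ infer $\vdash\phi_1\wedge\phi_2$; $\vee$-R$_1$/$\vee$-R$_2$: from $\vdash\phi_1$ (resp. $\vdash\phi_2$) infer $\vdash\phi_1\vee\phi_2$;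 EX-R: from $\vdash(s'/x)\phi$ with $s'\in\mathsf{Next}(s)$ infer $\vdash EX_x(\phi)(s)$; AX-R: from $\vdash(s_i/x)\phi$ for all $s_i$ in $\mathsf{Next}(s)=\{s_1,\dots,s_n\}$ infer $\vdash AX_x(\phi)(s)$; AF-R$_1$: from $\vdash(s/x)\phi$ infer $\vdash AF_x(\phi)(s)$; AF-R$_2$: from $\vdash AF_x(\phi)(s_i)$ for all $s_i\in\mathsf{Next}(s)$ infer $\vdash AF_x(\phi)(s)$; EG-R: from $\vdash(s/x)\phi$ and $\Gamma,EG_x(\phi)(s)\vdash EG_x(\phi)(s')$ with $s'\in\mathsf{Next}(s)$ infer $\Gamma\vdash EG_x(\phi)(s)$; EG-merge: $\Gamma\vdash EG_x(\phi)(s)$ if $EG_x(\phi)(s)\in\Gamma$; AR-R$_1$: from $\vdash(s/y)\phi_2$ and $\Gamma'\vdash AR_{x,y}(\phi_1,\phi_2)(s_i)$ for all $s_i\in\mathsf{Next}(s)$, where $\Gamma'=\Gamma,AR_{x,y}(\phi_1,\phi_2)(s)$, infer $\Gamma\vdash AR_{x,y}(\phi_1,\phi_2)(s)$; AR-R$_2$: from $\vdash(s/x)\phi_1$ and $\vdash(s/y)\phi_2$ infer $\Gamma\vdash AR_{x,y}(\phi_1,\phi_2)(s)$; AR-merge: $\Gamma\vdash AR_{x,y}(\phi_1,\phi_2)(s)$ if $AR_{x,y}(\phi_1,\phi_2)(s)\in\Gamma$; EU-R$_1$: from $\vdash(s/y)\phi_2$ infer $\vdash EU_{x,y}(\phi_1,\phi_2)(s)$;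 EU-R$_2$: from $\vdash(s/x)\phi_1$ and $\vdash EU_{x,y}(\phi_1,\phi_2)(s')$ with $s'\in\mathsf{Next}(s)$ infer $\vdash EU_{x,y}(\phi_1,\phi_2)(s)$. *)

theory Defs
  imports Main "HOL-Library.FSet"
begin

section \<open>Kripke models\<close>

record ('s, 'p) kripke =
  states :: "'s set"
  step :: "('s \<times> 's) set"
  preds :: "'p set"
  arity :: "'p \<Rightarrow> nat"
  rel :: "'p \<Rightarrow> 's list set"

locale kripke_model =
  fixes M :: "('s, 'p) kripke"
  assumes finite_states: "finite (states M)"
    and states_nonempty: "states M \<noteq> {}"
    and step_states: "step M \<subseteq> states M \<times> states M"
    and step_total: "\<And>s. s \<in> states M \<Longrightarrow> \<exists>s'. (s, s') \<in> step M"
    and rel_states: "\<And>p. p \<in> preds M \<Longrightarrow>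
          rel M p \<subseteq> {ss. set ss \<subseteq> states M \<and> length ss = arity M p}"

definition Next :: "('s, 'p) kripke \<Rightarrow> 's \<Rightarrow> 's set" where
  "Next M s = {s'. (s, s') \<in> step M}"

text \<open>A finite path of length \<open>n\<close> consists of the values at \<open>0, \<dots>, n\<close>;
  the remaining values of the function are irrelevant.\<close>

definition finite_path :: "('s, 'p) kripke \<Rightarrow> nat \<Rightarrow> (nat \<Rightarrow> 's) \<Rightarrow> bool" where
  "finite_path M n \<pi> \<longleftrightarrow> (\<forall>i<n. \<pi> (Suc i) \<in> Next M (\<pi> i))"

definition infinite_path :: "('s, 'p) kripke \<Rightarrow> (nat \<Rightarrow> 's) \<Rightarrow> bool" where
  "infinite_path M \<pi> \<longleftrightarrow> (\<forall>i. \<pi> (Suc i) \<in> Next M (\<pi> i))"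


section \<open>Possibly infinite labelled trees\<close>

codatatype 'a tree = Node (label: 'a) (children: "'a tree list")

text \<open>Nodes are represented by the subtrees rooted at them. A leaf is a node without children.\<close>

inductive_set nodes :: "'a tree \<Rightarrow> 'a tree set" for t where
  root: "t \<in> nodes t"
| child: "u \<in> nodes t \<Longrightarrow> v \<in> set (children u) \<Longrightarrow> v \<in> nodes t"

text \<open>Branching is always finite, so the well-founded trees are exactly the finite ones.
  (Finiteness of \<open>nodes t\<close> would be too weak: an infinite tree may have only finitely
  many distinct subtrees.)\<close>

inductive finite_tree :: "'a tree \<Rightarrow> bool" where
  "(\<forall>u\<in>set (children t). finite_tree u) \<Longrightarrow> finite_tree t"

text \<open>Each internal node labelled \<open>s\<close> has one child for each element of \<open>Next M s\<close>.\<close>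

definition Next_tree :: "('s, 'p) kripke \<Rightarrow> 's tree \<Rightarrow> bool" where
  "Next_tree M t \<longleftrightarrow> (\<forall>u\<in>nodes t. children u \<noteq> [] \<longrightarrow>
     distinct (map label (children u)) \<and>
     set (map label (children u)) = Next M (label u))"


section \<open>Formulas\<close>

type_synonym var = nat

datatype 's trm = Var var | Const 's

text \<open>The suffix is needed because \<open>EX\<close> alone is a quantifier token.
  In \<open>AR_of x y \<phi>\<^sub>1 \<phi>\<^sub>2 t\<close> and \<open>EU_of x y \<phi>\<^sub>1 \<phi>\<^sub>2 t\<close> the variable \<open>x\<close> is bound in \<open>\<phi>\<^sub>1\<close> only and
  \<open>y\<close> in \<open>\<phi>\<^sub>2\<close> only; no modality binds variables in its term argument.\<close>

datatype ('s, 'p) fm =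
    Top
  | Bot
  | Atom 'p "'s trm list"
  | NegAtom 'p "'s trm list"
  | Conj "('s, 'p) fm" "('s, 'p) fm"
  | Disj "('s, 'p) fm" "('s, 'p) fm"
  | AX_of var "('s, 'p) fm" "'s trm"
  | EX_of var "('s, 'p) fm" "'s trm"
  | AF_of var "('s, 'p) fm" "'s trm"
  | EG_of var "('s, 'p) fm" "'s trm"
  | AR_of var var "('s, 'p) fm" "('s, 'p) fm" "'s trm"
  | EU_of var var "('s, 'p) fm" "('s, 'p) fm" "'s trm"

primrec trm_over :: "('s, 'p) kripke \<Rightarrow> 's trm \<Rightarrow> bool" where
  "trm_over M (Var x) \<longleftrightarrow> True"
| "trm_over M (Const s) \<longleftrightarrow> s \<in> states M"

primrec fm_over :: "('s, 'p) kripke \<Rightarrow> ('s, 'p) fm \<Rightarrow> bool" where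
  "fm_over M Top \<longleftrightarrow> True"
| "fm_over M Bot \<longleftrightarrow> True"
| "fm_over M (Atom p ts) \<longleftrightarrow> p \<in> preds M \<and> length ts = arity M p \<and> (\<forall>t\<in>set ts. trm_over M t)"
| "fm_over M (NegAtom p ts) \<longleftrightarrow> p \<in> preds M \<and> length ts = arity M p \<and> (\<forall>t\<in>set ts. trm_over M t)"
| "fm_over M (Conj \<phi> \<psi>) \<longleftrightarrow> fm_over M \<phi> \<and> fm_over M \<psi>"
| "fm_over M (Disj \<phi> \<psi>) \<longleftrightarrow> fm_over M \<phi> \<and> fm_over M \<psi>"
| "fm_over M (AX_of x \<phi> t) \<longleftrightarrow> fm_over M \<phi> \<and> trm_over M t"
| "fm_over M (EX_of x \<phi> t) \<longleftrightarrow> fm_over M \<phi> \<and> trm_over M t"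
| "fm_over M (AF_of x \<phi> t) \<longleftrightarrow> fm_over M \<phi> \<and> trm_over M t"
| "fm_over M (EG_of x \<phi> t) \<longleftrightarrow> fm_over M \<phi> \<and> trm_over M t"
| "fm_over M (AR_of x y \<phi> \<psi> t) \<longleftrightarrow> fm_over M \<phi> \<and> fm_over M \<psi> \<and> trm_over M t"
| "fm_over M (EU_of x y \<phi> \<psi> t) \<longleftrightarrow> fm_over M \<phi> \<and> fm_over M \<psi> \<and> trm_over M t"

primrec fv_trm :: "'s trm \<Rightarrow> var set" where
  "fv_trm (Var x) = {x}"
| "fv_trm (Const s) = {}"

primrec fv :: "('s, 'p) fm \<Rightarrow> var set" where
  "fv Top = {}"
| "fv Bot = {}"
| "fv (Atom p ts) = (\<Union>t\<in>set ts. fv_trm t)"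
| "fv (NegAtom p ts) = (\<Union>t\<in>set ts. fv_trm t)"
| "fv (Conj \<phi> \<psi>) = fv \<phi> \<union> fv \<psi>"
| "fv (Disj \<phi> \<psi>) = fv \<phi> \<union> fv \<psi>"
| "fv (AX_of x \<phi> t) = (fv \<phi> - {x}) \<union> fv_trm t"
| "fv (EX_of x \<phi> t) = (fv \<phi> - {x}) \<union> fv_trm t"
| "fv (AF_of x \<phi> t) = (fv \<phi> - {x}) \<union> fv_trm t"
| "fv (EG_of x \<phi> t) = (fv \<phi> - {x}) \<union> fv_trm t"
| "fv (AR_of x y \<phi> \<psi> t) = (fv \<phi> - {x}) \<union> (fv \<psi> - {y}) \<union> fv_trm t"
| "fv (EU_of x y \<phi> \<psi> t) = (fv \<phi> - {x}) \<union> (fv \<psi> - {y}) \<union> fv_trm t"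

definition closed_fm :: "('s, 'p) fm \<Rightarrow> bool" where
  "closed_fm \<phi> \<longleftrightarrow> fv \<phi> = {}"

text \<open>\<open>subst s x \<phi>\<close> is \<open>(s/x)\<phi>\<close>. Validity and the proof rules substitute only constants.
  These contain no variables, so nothing can be captured and no renaming is needed.\<close>

primrec subst_trm :: "'s \<Rightarrow> var \<Rightarrow> 's trm \<Rightarrow> 's trm" where
  "subst_trm s x (Var y) = (if x = y then Const s else Var y)"
| "subst_trm s x (Const s') = Const s'"

primrec subst :: "'s \<Rightarrow> var \<Rightarrow> ('s, 'p) fm \<Rightarrow> ('s, 'p) fm" where
  "subst s z Top = Top"
| "subst s z Bot = Bot"
| "subst s z (Atom p ts) = Atom p (map (subst_trm s z) ts)"
| "subst s z (NegAtom p ts) = NegAtom p (map (subst_trm s z) ts)"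
| "subst s z (Conj \<phi> \<psi>) = Conj (subst s z \<phi>) (subst s z \<psi>)"
| "subst s z (Disj \<phi> \<psi>) = Disj (subst s z \<phi>) (subst s z \<psi>)"
| "subst s z (AX_of x \<phi> t) = AX_of x (if z = x then \<phi> else subst s z \<phi>) (subst_trm s z t)"
| "subst s z (EX_of x \<phi> t) = EX_of x (if z = x then \<phi> else subst s z \<phi>) (subst_trm s z t)"
| "subst s z (AF_of x \<phi> t) = AF_of x (if z = x then \<phi> else subst s z \<phi>) (subst_trm s z t)"
| "subst s z (EG_of x \<phi> t) = EG_of x (if z = x then \<phi> else subst s z \<phi>) (subst_trm s z t)"
| "subst s z (AR_of x y \<phi> \<psi> t) =
     AR_of x y (if z = x then \<phi> else subst s z \<phi>) (if z = y then \<psi> else subst s z \<psi>) (subst_trm s z t)"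
| "subst s z (EU_of x y \<phi> \<psi> t) =
     EU_of x y (if z = x then \<phi> else subst s z \<phi>) (if z = y then \<psi> else subst s z \<psi>) (subst_trm s z t)"


section \<open>Validity\<close>

text \<open>Termination measure: unlike \<open>size\<close>, it ignores terms and is therefore invariant
  under substitution.\<close>

primrec height :: "('s, 'p) fm \<Rightarrow> nat" where
  "height Top = 0"
| "height Bot = 0"
| "height (Atom p ts) = 0"
| "height (NegAtom p ts) = 0"
| "height (Conj \<phi> \<psi>) = Suc (max (height \<phi>) (height \<psi>))"
| "height (Disj \<phi> \<psi>) = Suc (max (height \<phi>) (height \<psi>))"
| "height (AX_of x \<phi> t) = Suc (height \<phi>)"
| "height (EX_of x \<phi> t) = Suc (height \<phi>)"
| "height (AF_of x \<phi> t) = Suc (height \<phi>)"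
| "height (EG_of x \<phi> t) = Suc (height \<phi>)"
| "height (AR_of x y \<phi> \<psi> t) = Suc (max (height \<phi>) (height \<psi>))"
| "height (EU_of x y \<phi> \<psi> t) = Suc (max (height \<phi>) (height \<psi>))"

lemma height_subst [simp]: "height (subst s x \<phi>) = height \<phi>"
  by (induction \<phi>) auto

text \<open>Validity is meant for closed formulas; the last equation and the existential
  quantifiers in the atomic cases make the function total by returning \<open>False\<close>
  when a variable occurs as an argument.\<close>

function (sequential) valid :: "('s, 'p) kripke \<Rightarrow> ('s, 'p) fm \<Rightarrow> bool"
  (infix "\<Turnstile>" 50) where
  "M \<Turnstile> Top \<longleftrightarrow> True"
| "M \<Turnstile> Bot \<longleftrightarrow> False"
| "M \<Turnstile> Atom p ts \<longleftrightarrow> (\<exists>ss. ts = map Const ss \<and> ss \<in> rel M p)"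
| "M \<Turnstile> NegAtom p ts \<longleftrightarrow> (\<exists>ss. ts = map Const ss \<and> ss \<notin> rel M p)"
| "M \<Turnstile> Conj \<phi> \<psi> \<longleftrightarrow> M \<Turnstile> \<phi> \<and> M \<Turnstile> \<psi>"
| "M \<Turnstile> Disj \<phi> \<psi> \<longleftrightarrow> M \<Turnstile> \<phi> \<or> M \<Turnstile> \<psi>"
| "M \<Turnstile> AX_of x \<phi> (Const s) \<longleftrightarrow> (\<forall>s'\<in>Next M s. M \<Turnstile> subst s' x \<phi>)"
| "M \<Turnstile> EX_of x \<phi> (Const s) \<longleftrightarrow> (\<exists>s'\<in>Next M s. M \<Turnstile> subst s' x \<phi>)"
| "M \<Turnstile> AF_of x \<phi> (Const s) \<longleftrightarrow>
     (\<exists>t. finite_tree t \<and> Next_tree M t \<and> label t = s \<and>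
        (\<forall>u\<in>nodes t. children u = [] \<longrightarrow> M \<Turnstile> subst (label u) x \<phi>))"
| "M \<Turnstile> EG_of x \<phi> (Const s) \<longleftrightarrow>
     (\<exists>\<pi>. infinite_path M \<pi> \<and> \<pi> 0 = s \<and> (\<forall>i. M \<Turnstile> subst (\<pi> i) x \<phi>))"
| "M \<Turnstile> AR_of x y \<phi> \<psi> (Const s) \<longleftrightarrow>
     (\<exists>t. Next_tree M t \<and> label t = s \<and>
        (\<forall>u\<in>nodes t. M \<Turnstile> subst (label u) y \<psi>) \<and>
        (\<forall>u\<in>nodes t. children u = [] \<longrightarrow> M \<Turnstile> subst (label u) x \<phi>))"
| "M \<Turnstile> EU_of x y \<phi> \<psi> (Const s) \<longleftrightarrow>
     (\<exists>\<pi> n. finite_path M n \<pi> \<and> \<pi> 0 = s \<and>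
        M \<Turnstile> subst (\<pi> n) y \<psi> \<and> (\<forall>i<n. M \<Turnstile> subst (\<pi> i) x \<phi>))"
| "M \<Turnstile> _ \<longleftrightarrow> False"
  by pat_completeness auto

termination
  by (relation "measure (\<lambda>(M, \<phi>). height \<phi>)") (auto simp: less_Suc_eq_le)


section \<open>The proof system\<close>

text \<open>Derivations are built from the rules with premises for all elements of \<open>Next M s\<close>,
  a finite set in a Kripke model; hence inductive derivability coincides with the existence
  of a finite derivation tree.\<close>

inductive sctl :: "('s, 'p) kripke \<Rightarrow> ('s, 'p) fm fset \<Rightarrow> ('s, 'p) fm \<Rightarrow> bool"
  ("SCTL'(_') : _ \<turnstile> _" [0, 51, 51] 50) for M where
  atom_R: "ss \<in> rel M p \<Longrightarrow> SCTL(M) : {||} \<turnstile> Atom p (map Const ss)"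
| neg_R: "ss \<notin> rel M p \<Longrightarrow> SCTL(M) : {||} \<turnstile> NegAtom p (map Const ss)"
| top_R: "SCTL(M) : {||} \<turnstile> Top"
| conj_R: "SCTL(M) : {||} \<turnstile> \<phi> \<Longrightarrow> SCTL(M) : {||} \<turnstile> \<psi> \<Longrightarrow> SCTL(M) : {||} \<turnstile> Conj \<phi> \<psi>"
| disj_R1: "SCTL(M) : {||} \<turnstile> \<phi> \<Longrightarrow> SCTL(M) : {||} \<turnstile> Disj \<phi> \<psi>"
| disj_R2: "SCTL(M) : {||} \<turnstile> \<psi> \<Longrightarrow> SCTL(M) : {||} \<turnstile> Disj \<phi> \<psi>"
| EX_R: "s' \<in> Next M s \<Longrightarrow> SCTL(M) : {||} \<turnstile> subst s' x \<phi> \<Longrightarrow> SCTL(M) : {||} \<turnstile> EX_of x \<phi> (Const s)"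
| AX_R: "(\<And>s'. s' \<in> Next M s \<Longrightarrow> SCTL(M) : {||} \<turnstile> subst s' x \<phi>) \<Longrightarrow>
    SCTL(M) : {||} \<turnstile> AX_of x \<phi> (Const s)"
| AF_R1: "SCTL(M) : {||} \<turnstile> subst s x \<phi> \<Longrightarrow> SCTL(M) : {||} \<turnstile> AF_of x \<phi> (Const s)"
| AF_R2: "(\<And>s'. s' \<in> Next M s \<Longrightarrow> SCTL(M) : {||} \<turnstile> AF_of x \<phi> (Const s')) \<Longrightarrow>
    SCTL(M) : {||} \<turnstile> AF_of x \<phi> (Const s)"
| EG_R: "SCTL(M) : {||} \<turnstile> subst s x \<phi> \<Longrightarrow> s' \<in> Next M s \<Longrightarrow>
    SCTL(M) : finsert (EG_of x \<phi> (Const s)) \<Gamma> \<turnstile> EG_of x \<phi> (Const s') \<Longrightarrow>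
    SCTL(M) : \<Gamma> \<turnstile> EG_of x \<phi> (Const s)"
| EG_merge: "EG_of x \<phi> (Const s) |\<in>| \<Gamma> \<Longrightarrow> SCTL(M) : \<Gamma> \<turnstile> EG_of x \<phi> (Const s)"
| AR_R1: "SCTL(M) : {||} \<turnstile> subst s y \<psi> \<Longrightarrow>
    (\<And>s'. s' \<in> Next M s \<Longrightarrow>
       SCTL(M) : finsert (AR_of x y \<phi> \<psi> (Const s)) \<Gamma> \<turnstile> AR_of x y \<phi> \<psi> (Const s')) \<Longrightarrow>
    SCTL(M) : \<Gamma> \<turnstile> AR_of x y \<phi> \<psi> (Const s)"
| AR_R2: "SCTL(M) : {||} \<turnstile> subst s x \<phi> \<Longrightarrow> SCTL(M) : {||} \<turnstile> subst s y \<psi> \<Longrightarrow>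
    SCTL(M) : \<Gamma> \<turnstile> AR_of x y \<phi> \<psi> (Const s)"
| AR_merge: "AR_of x y \<phi> \<psi> (Const s) |\<in>| \<Gamma> \<Longrightarrow> SCTL(M) : \<Gamma> \<turnstile> AR_of x y \<phi> \<psi> (Const s)"
| EU_R1: "SCTL(M) : {||} \<turnstile> subst s y \<psi> \<Longrightarrow> SCTL(M) : {||} \<turnstile> EU_of x y \<phi> \<psi> (Const s)"
| EU_R2: "SCTL(M) : {||} \<turnstile> subst s x \<phi> \<Longrightarrow> s' \<in> Next M s \<Longrightarrow>
    SCTL(M) : {||} \<turnstile> EU_of x y \<phi> \<psi> (Const s') \<Longrightarrow> SCTL(M) : {||} \<turnstile> EU_of x y \<phi> \<psi> (Const s)"

end

theory Submission imports Defs begin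

text \<open>The four recursive modalities are matched with fixpoints on sets of states: \<open>AF\<close> and \<open>EU\<close> with
  least ones, \<open>EG\<close> and \<open>AR\<close> with greatest ones. A context \<open>\<Gamma>\<close> in a proof of an \<open>EG\<close>- or
  \<open>AR\<close>-formula records a set \<open>A\<close> of states assumed to be good, and derivability corresponds to
  membership in \<open>gfp (\<lambda>X. A \<union> F X)\<close>. The merge rules are sound because a state whose goodness follows
  productively from its own assumption is good outright, and complete because every step
  adds a state to \<open>A\<close>, which can happen only finitely often.\<close>

section \<open>Greatest fixpoints with accumulated assumptions\<close>

lemma mono_Un_left: "mono F \<Longrightarrow> mono (\<lambda>X. A \<union> F X)" for F :: "'a set \<Rightarrow> 'a set"
  by (auto simp: mono_def)

text \<open>The hypothesis \<open>s \<in> F Y\<close>, for \<open>Y\<close> the fixpoint that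
  assumes \<open>s\<close>, makes the summand \<open>insert s\<close> redundant:
  \<open>Y \<subseteq> A \<union> F Y\<close> already holds, and coinduction gives the claim. This
  is the soundness of a rule whose premise has its own conclusion in the context.\<close>

lemma gfp_discharge_assumption:
  fixes F :: "'a set \<Rightarrow> 'a set"
  assumes "mono F" and s: "s \<in> F (gfp (\<lambda>X. insert s A \<union> F X))"
  shows "s \<in> gfp (\<lambda>X. A \<union> F X)"
proof -
  let ?Y = "gfp (\<lambda>X. insert s A \<union> F X)"
  have Y: "?Y = insert s A \<union> F ?Y"
    by (rule gfp_unfold[OF mono_Un_left[OF assms(1)]])
  then have "?Y \<subseteq> A \<union> F ?Y" using s equalityD1[OF Y] by blast
  then have "?Y \<subseteq> gfp (\<lambda>X. A \<union> F X)" by (rule gfp_upperbound)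
  then show ?thesis using Y by blast
qed

text \<open>Induction on the number of elements of the finite bound \<open>S\<close> outside
  \<open>A\<close>. An element \<open>s\<close> of the fixpoint not in \<open>A\<close> lies in
  \<open>F\<close> of the fixpoint, hence in \<open>S\<close>, so adding it to \<open>A\<close>
  decreases this number. The case \<open>step\<close> mirrors a proof rule read from conclusion to
  premises.\<close>

lemma gfp_accumulate_induct [consumes 3, case_names bounded assumption step]:
  fixes F :: "'a set \<Rightarrow> 'a set"
  assumes "mono F" and "finite S" and "s \<in> gfp (\<lambda>X. A \<union> F X)"
    and bound: "\<And>X. F X \<subseteq> S"
    and assumption: "\<And>A s. s \<in> A \<Longrightarrow> R A s"
    and step: "\<And>A s Y. s \<in> F Y \<Longrightarrow> (\<And>y. y \<in> Y \<Longrightarrow> R (insert s A) y) \<Longrightarrow> R A s"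
  shows "R A s"
  using assms(3)
proof (induction "card (S - A)" arbitrary: A s rule: less_induct)
  case less
  let ?G = "\<lambda>A. gfp (\<lambda>X. A \<union> F X)"
  show ?case
  proof (cases "s \<in> A")
    case False
    have "?G A = A \<union> F (?G A)"
      by (rule gfp_unfold[OF mono_Un_left[OF assms(1)]])
    then have s: "s \<in> F (?G A)" using less.prems False by blast
    then have "s \<in> S" using bound by blast
    then have "card (S - insert s A) < card (S - A)"
      using False assms(2) by (intro psubset_card_mono) auto
    \<comment> \<open>Enlarging the assumptions enlarges the fixpoint, so the induction hypothesis
      for \<open>insert s A\<close> covers all of \<open>?G A\<close>, which serves as the set
      \<open>Y\<close> in \<open>step\<close>.\<close>
    moreover have "?G A \<subseteq> ?G (insert s A)" by (rule gfp_mono) auto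
    ultimately have "R (insert s A) y" if "y \<in> ?G A" for y
      using less.hyps that by blast
    then show ?thesis by (rule step[OF s])
  qed (rule assumption)
qed

inductive_cases sctl_BotE: "SCTL(M) : \<Gamma> \<turnstile> Bot"
inductive_cases sctl_AtomE: "SCTL(M) : \<Gamma> \<turnstile> Atom p ts"
inductive_cases sctl_NegAtomE: "SCTL(M) : \<Gamma> \<turnstile> NegAtom p ts"
inductive_cases sctl_ConjE: "SCTL(M) : \<Gamma> \<turnstile> Conj \<phi> \<psi>"
inductive_cases sctl_DisjE: "SCTL(M) : \<Gamma> \<turnstile> Disj \<phi> \<psi>"
inductive_cases sctl_AXE: "SCTL(M) : \<Gamma> \<turnstile> AX_of x \<phi> t"
inductive_cases sctl_EXE: "SCTL(M) : \<Gamma> \<turnstile> EX_of x \<phi> t"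
text \<open>Every rule for these four modalities concludes a formula with a \<open>Const\<close>
  argument, so the \<open>Var\<close> instances yield contradictions. Derivations for
  \<open>Const\<close> arguments are treated by induction below.\<close>

inductive_cases sctl_AF_VarE: "SCTL(M) : \<Gamma> \<turnstile> AF_of x \<phi> (Var v)"
inductive_cases sctl_EG_VarE: "SCTL(M) : \<Gamma> \<turnstile> EG_of x \<phi> (Var v)"
inductive_cases sctl_AR_VarE: "SCTL(M) : \<Gamma> \<turnstile> AR_of x y \<phi> \<psi> (Var v)"
inductive_cases sctl_EU_VarE: "SCTL(M) : \<Gamma> \<turnstile> EU_of x y \<phi> \<psi> (Var v)"

context kripke_model
begin

lemma finite_Next: "finite (Next M s)"
  using finite_states step_states
  by (auto simp: Next_def intro: finite_subset[of _ "states M"])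

lemma Next_in_states: "s' \<in> Next M s \<Longrightarrow> s' \<in> states M"
  using step_states by (auto simp: Next_def)

lemma Next_nonempty: "s \<in> states M \<Longrightarrow> Next M s \<noteq> {}"
  using step_total by (auto simp: Next_def)

section \<open>State sets of the modalities\<close>

text \<open>The parameter is a predicate on states instead of a formula, so that this set can be
  compared with derivations and with trees independently. The two clauses follow
  \<open>AF_R1\<close> and \<open>AF_R2\<close>.\<close>

inductive_set AF_states :: "('s \<Rightarrow> bool) \<Rightarrow> 's set" for P where
  base: "s \<in> states M \<Longrightarrow> P s \<Longrightarrow> s \<in> AF_states P"
| step: "s \<in> states M \<Longrightarrow> (\<And>s'. s' \<in> Next M s \<Longrightarrow> s' \<in> AF_states P) \<Longrightarrow> s \<in> AF_states P"

inductive_set EU_states :: "('s \<Rightarrow> bool) \<Rightarrow> ('s \<Rightarrow> bool) \<Rightarrow> 's set" for P Q where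
  base: "s \<in> states M \<Longrightarrow> Q s \<Longrightarrow> s \<in> EU_states P Q"
| step: "s \<in> states M \<Longrightarrow> P s \<Longrightarrow> s' \<in> Next M s \<Longrightarrow> s' \<in> EU_states P Q \<Longrightarrow> s \<in> EU_states P Q"

text \<open>Given as an operator instead of a coinductive set, because contexts require the fixpoint
  of its union with a set of assumptions.\<close>

definition EG_step :: "('s \<Rightarrow> bool) \<Rightarrow> 's set \<Rightarrow> 's set" where
  "EG_step P X = {s \<in> states M. P s \<and> (\<exists>s'\<in>Next M s. s' \<in> X)}"

text \<open>The disjunct \<open>P s\<close> corresponds to a leaf and to \<open>AR_R2\<close>, the
  other one to an internal node and to \<open>AR_R1\<close>.\<close>

definition AR_step :: "('s \<Rightarrow> bool) \<Rightarrow> ('s \<Rightarrow> bool) \<Rightarrow> 's set \<Rightarrow> 's set" where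
  "AR_step P Q X = {s \<in> states M. Q s \<and> (P s \<or> Next M s \<subseteq> X)}"

lemma mono_EG_step: "mono (EG_step P)"
  by (auto simp: mono_def EG_step_def)

lemma mono_AR_step: "mono (AR_step P Q)"
  by (auto simp: mono_def AR_step_def)

section \<open>Derivability and fixpoints\<close>

lemma derivable_AF_iff:
  assumes P: "\<And>s. s \<in> states M \<Longrightarrow> (SCTL(M) : {||} \<turnstile> subst s x \<phi>) \<longleftrightarrow> P s"
    and "s \<in> states M"
  shows "(SCTL(M) : {||} \<turnstile> AF_of x \<phi> (Const s)) \<longleftrightarrow> s \<in> AF_states P"
proof
  assume "SCTL(M) : {||} \<turnstile> AF_of x \<phi> (Const s)"
  then show "s \<in> AF_states P"
    using assms(2)
    by (induction "{||} :: ('s, 'p) fm fset" "AF_of x \<phi> (Const s)" arbitrary: s rule: sctl.induct)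
      (auto intro: AF_states.intros simp: P Next_in_states)
next
  assume "s \<in> AF_states P"
  then show "SCTL(M) : {||} \<turnstile> AF_of x \<phi> (Const s)"
    by induction (auto intro: AF_R1 AF_R2 simp: P)
qed

lemma derivable_EU_iff:
  assumes P: "\<And>s. s \<in> states M \<Longrightarrow> (SCTL(M) : {||} \<turnstile> subst s x \<phi>) \<longleftrightarrow> P s"
    and Q: "\<And>s. s \<in> states M \<Longrightarrow> (SCTL(M) : {||} \<turnstile> subst s y \<psi>) \<longleftrightarrow> Q s"
    and "s \<in> states M"
  shows "(SCTL(M) : {||} \<turnstile> EU_of x y \<phi> \<psi> (Const s)) \<longleftrightarrow> s \<in> EU_states P Q"
proof
  assume "SCTL(M) : {||} \<turnstile> EU_of x y \<phi> \<psi> (Const s)"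
  then show "s \<in> EU_states P Q"
    using assms(3)
    by (induction "{||} :: ('s, 'p) fm fset" "EU_of x y \<phi> \<psi> (Const s)" arbitrary: s rule: sctl.induct)
      (auto intro: EU_states.intros simp: P Q Next_in_states)
next
  assume "s \<in> EU_states P Q"
  then show "SCTL(M) : {||} \<turnstile> EU_of x y \<phi> \<psi> (Const s)"
    by induction (auto intro: EU_R1 EU_R2 simp: P Q)
qed

text \<open>Both directions are proved for arbitrary contexts, with
  \<open>gfp (\<lambda>X. A \<Gamma> \<union> EG_step P X)\<close> in place of
  \<open>gfp (EG_step P)\<close>; the claim is the case of the empty context.\<close>

lemma derivable_EG_iff:
  assumes P: "\<And>s. s \<in> states M \<Longrightarrow> (SCTL(M) : {||} \<turnstile> subst s x \<phi>) \<longleftrightarrow> P s"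
    and "s \<in> states M"
  shows "(SCTL(M) : {||} \<turnstile> EG_of x \<phi> (Const s)) \<longleftrightarrow> s \<in> gfp (EG_step P)"
proof
  \<comment> \<open>Only instances of the formula under consideration matter in
    \<open>\<Gamma>\<close>, since \<open>EG_merge\<close> can use no others.\<close>
  define A where "A = (\<lambda>\<Gamma>. {s. EG_of x \<phi> (Const s) |\<in>| \<Gamma>})"
  have A_empty: "A {||} = {}" and
    A_insert: "A (finsert (EG_of x \<phi> (Const s)) \<Gamma>) = insert s (A \<Gamma>)" for s \<Gamma>
    by (auto simp: A_def)
  have sound: "s \<in> gfp (\<lambda>X. A \<Gamma> \<union> EG_step P X)"
    if "SCTL(M) : \<Gamma> \<turnstile> EG_of x \<phi> (Const s)" "s \<in> states M" for \<Gamma> s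
    using that
  proof (induction \<Gamma> "EG_of x \<phi> (Const s)" arbitrary: s rule: sctl.induct)
    case (EG_R s s' \<Gamma>)
    then have "s \<in> EG_step P (gfp (\<lambda>X. insert s (A \<Gamma>) \<union> EG_step P X))"
      by (auto simp: EG_step_def A_insert P Next_in_states)
    \<comment> \<open>The premise of \<open>EG_R\<close> assumes the formula for \<open>s\<close>
      itself. Since \<open>P s\<close> holds and a successor of \<open>s\<close> lies in the
      enlarged fixpoint, this assumption can be removed.\<close>
    then show ?case by (rule gfp_discharge_assumption[OF mono_EG_step])
  next
    case (EG_merge \<Gamma> s)
    then show ?case
      by (subst gfp_unfold[OF mono_Un_left[OF mono_EG_step]]) (simp add: A_def)
  qed
  show "s \<in> gfp (EG_step P)" if "SCTL(M) : {||} \<turnstile> EG_of x \<phi> (Const s)"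
    using sound[OF that assms(2)] by (simp add: A_empty)
  show "SCTL(M) : {||} \<turnstile> EG_of x \<phi> (Const s)" if "s \<in> gfp (EG_step P)"
  proof -
    \<comment> \<open>The induction runs over sets of states, and several contexts can have the same
      set \<open>B\<close>; hence the quantifier over \<open>\<Gamma>\<close> inside the induction
      predicate.\<close>
    have "\<forall>\<Gamma>. A \<Gamma> = B \<longrightarrow> SCTL(M) : \<Gamma> \<turnstile> EG_of x \<phi> (Const s)"
      if "s \<in> gfp (\<lambda>X. B \<union> EG_step P X)" for B s
      using mono_EG_step finite_states that
    proof (induction B s rule: gfp_accumulate_induct)
      case (assumption B s)
      then show ?case by (auto simp: A_def intro: EG_merge)
    next
      case (step B s Y)
      then show ?case by (auto simp: EG_step_def A_insert P intro: EG_R)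
    qed (auto simp: EG_step_def)
    from this[where B = "{}" and s = s] show ?thesis using that A_empty by simp
  qed
qed

text \<open>The argument is that for \<open>EG\<close>, with all successors in place of one and with
  the additional way \<open>AR_R2\<close> to close a branch.\<close>

lemma derivable_AR_iff:
  assumes P: "\<And>s. s \<in> states M \<Longrightarrow> (SCTL(M) : {||} \<turnstile> subst s x \<phi>) \<longleftrightarrow> P s"
    and Q: "\<And>s. s \<in> states M \<Longrightarrow> (SCTL(M) : {||} \<turnstile> subst s y \<psi>) \<longleftrightarrow> Q s"
    and "s \<in> states M"
  shows "(SCTL(M) : {||} \<turnstile> AR_of x y \<phi> \<psi> (Const s)) \<longleftrightarrow> s \<in> gfp (AR_step P Q)"
proof
  define A where "A = (\<lambda>\<Gamma>. {s. AR_of x y \<phi> \<psi> (Const s) |\<in>| \<Gamma>})"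
  have A_empty: "A {||} = {}" and
    A_insert: "A (finsert (AR_of x y \<phi> \<psi> (Const s)) \<Gamma>) = insert s (A \<Gamma>)" for s \<Gamma>
    by (auto simp: A_def)
  have sound: "s \<in> gfp (\<lambda>X. A \<Gamma> \<union> AR_step P Q X)"
    if "SCTL(M) : \<Gamma> \<turnstile> AR_of x y \<phi> \<psi> (Const s)" "s \<in> states M" for \<Gamma> s
    using that
  proof (induction \<Gamma> "AR_of x y \<phi> \<psi> (Const s)" arbitrary: s rule: sctl.induct)
    case (AR_R1 s \<Gamma>)
    then have "s \<in> AR_step P Q (gfp (\<lambda>X. insert s (A \<Gamma>) \<union> AR_step P Q X))"
      by (auto simp: AR_step_def A_insert Q Next_in_states)
    then show ?case by (rule gfp_discharge_assumption[OF mono_AR_step])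
  next
    case (AR_R2 s \<Gamma>)
    then show ?case
      by (subst gfp_unfold[OF mono_Un_left[OF mono_AR_step]]) (simp add: AR_step_def P Q)
  next
    case (AR_merge \<Gamma> s)
    then show ?case
      by (subst gfp_unfold[OF mono_Un_left[OF mono_AR_step]]) (simp add: A_def)
  qed
  show "s \<in> gfp (AR_step P Q)" if "SCTL(M) : {||} \<turnstile> AR_of x y \<phi> \<psi> (Const s)"
    using sound[OF that assms(3)] by (simp add: A_empty)
  show "SCTL(M) : {||} \<turnstile> AR_of x y \<phi> \<psi> (Const s)" if "s \<in> gfp (AR_step P Q)"
  proof -
    have "\<forall>\<Gamma>. A \<Gamma> = B \<longrightarrow> SCTL(M) : \<Gamma> \<turnstile> AR_of x y \<phi> \<psi> (Const s)"
      if "s \<in> gfp (\<lambda>X. B \<union> AR_step P Q X)" for B s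
      using mono_AR_step finite_states that
    proof (induction B s rule: gfp_accumulate_induct)
      case (assumption B s)
      then show ?case by (auto simp: A_def intro: AR_merge)
    next
      case (step B s Y)
      then have "s \<in> states M" "Q s" "P s \<or> Next M s \<subseteq> Y" by (auto simp: AR_step_def)
      then show ?case
      proof (elim disjE)
        assume "s \<in> states M" "Q s" "P s"
        then show ?thesis by (simp add: AR_R2 P Q)
      next
        assume s: "s \<in> states M" "Q s" "Next M s \<subseteq> Y"
        show ?thesis
        proof (intro allI impI)
          fix \<Gamma>
          assume "A \<Gamma> = B"
          \<comment> \<open>One extended context serves all branches: its set of states is
            \<open>insert s B\<close>, for which the induction hypothesis covers every element of
            \<open>Y\<close>, and \<open>Y\<close> contains all successors of
            \<open>s\<close>.\<close>
          with step(2) s(3)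
          have "SCTL(M) : finsert (AR_of x y \<phi> \<psi> (Const s)) \<Gamma> \<turnstile> AR_of x y \<phi> \<psi> (Const s')"
            if "s' \<in> Next M s" for s'
            using that by (auto simp: A_insert)
          moreover have "SCTL(M) : {||} \<turnstile> subst s y \<psi>" using s(1,2) by (simp add: Q)
          ultimately show "SCTL(M) : \<Gamma> \<turnstile> AR_of x y \<phi> \<psi> (Const s)"
            by (rule AR_R1[rotated])
        qed
      qed
    qed (auto simp: AR_step_def)
    from this[where B = "{}" and s = s] show ?thesis using that A_empty by simp
  qed
qed

section \<open>Paths, trees and fixpoints\<close>

lemma EU_states_iff_path:
  assumes "s \<in> states M"
  shows "s \<in> EU_states P Q \<longleftrightarrow>
    (\<exists>\<pi> n. finite_path M n \<pi> \<and> \<pi> 0 = s \<and> Q (\<pi> n) \<and> (\<forall>i<n. P (\<pi> i)))"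
proof
  assume "s \<in> EU_states P Q"
  then show "\<exists>\<pi> n. finite_path M n \<pi> \<and> \<pi> 0 = s \<and> Q (\<pi> n) \<and> (\<forall>i<n. P (\<pi> i))"
  proof induction
    case (base s)
    then show ?case by (intro exI[of _ "\<lambda>_. s"] exI[of _ 0]) (auto simp: finite_path_def)
  next
    case (step s s')
    then obtain \<pi> n where "finite_path M n \<pi>" "\<pi> 0 = s'" "Q (\<pi> n)" "\<forall>i<n. P (\<pi> i)" by blast
    with step show ?case
      \<comment> \<open>Prepending \<open>s\<close> to the path from its successor shifts all
        indices by one.\<close>
      by (intro exI[of _ "case_nat s \<pi>"] exI[of _ "Suc n"])
        (auto simp: finite_path_def less_Suc_eq_0_disj split: nat.split)
  qed
next
  assume "\<exists>\<pi> n. finite_path M n \<pi> \<and> \<pi> 0 = s \<and> Q (\<pi> n) \<and> (\<forall>i<n. P (\<pi> i))"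
  then obtain \<pi> n where "finite_path M n \<pi>" "\<pi> 0 = s" "Q (\<pi> n)" "\<forall>i<n. P (\<pi> i)" by blast
  with assms show "s \<in> EU_states P Q"
  proof (induction n arbitrary: \<pi> s)
    case 0
    then show ?case by (auto intro: EU_states.base)
  next
    case (Suc n)
    have next_s: "\<pi> 1 \<in> Next M s" using Suc.prems by (auto simp: finite_path_def)
    \<comment> \<open>The path without its first state starts at \<open>\<pi> 1\<close> and is
      shorter by one step.\<close>
    have "\<pi> 1 \<in> EU_states P Q"
      using Suc.prems Next_in_states[OF next_s]
      by (intro Suc.IH[of _ "\<lambda>i. \<pi> (Suc i)"]) (auto simp: finite_path_def)
    then show ?case using Suc.prems next_s by (auto intro: EU_states.step)
  qed
qed

text \<open>From left to right, dependent choice picks successors that stay in the fixpoint.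
  Conversely, the range of a path through \<open>P\<close>-states is a post-fixpoint of
  \<open>EG_step P\<close>.\<close>

lemma EG_gfp_iff_path:
  assumes "s \<in> states M"
  shows "s \<in> gfp (EG_step P) \<longleftrightarrow> (\<exists>\<pi>. infinite_path M \<pi> \<and> \<pi> 0 = s \<and> (\<forall>i. P (\<pi> i)))"
proof
  assume s: "s \<in> gfp (EG_step P)"
  have "x \<in> EG_step P (gfp (EG_step P))" if "x \<in> gfp (EG_step P)" for x
    using that gfp_unfold[OF mono_EG_step] by blast
  then have unfold: "P x \<and> (\<exists>x'\<in>Next M x. x' \<in> gfp (EG_step P))" if "x \<in> gfp (EG_step P)" for x
    using that by (auto simp: EG_step_def)
  \<comment> \<open>The conjunct on \<open>n = 0\<close> pins the start to \<open>s\<close>, as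
    dependent choice by itself leaves the first element open.\<close>
  then have "\<exists>\<pi>. \<forall>n. \<pi> n \<in> gfp (EG_step P) \<and> (n = 0 \<longrightarrow> \<pi> n = s) \<and> \<pi> (Suc n) \<in> Next M (\<pi> n)"
    using s
    by (intro dependent_nat_choice[of "\<lambda>n x. x \<in> gfp (EG_step P) \<and> (n = 0 \<longrightarrow> x = s)"
          "\<lambda>n x y. y \<in> Next M x", simplified conj_assoc]) auto
  then show "\<exists>\<pi>. infinite_path M \<pi> \<and> \<pi> 0 = s \<and> (\<forall>i. P (\<pi> i))"
    using unfold by (auto simp: infinite_path_def)
next
  assume "\<exists>\<pi>. infinite_path M \<pi> \<and> \<pi> 0 = s \<and> (\<forall>i. P (\<pi> i))"
  then obtain \<pi> where \<pi>: "infinite_path M \<pi>" "\<pi> 0 = s" "\<forall>i. P (\<pi> i)" by blast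
  have "\<pi> i \<in> states M" for i
    using \<pi> assms by (cases i) (auto simp: infinite_path_def intro: Next_in_states)
  then have "range \<pi> \<subseteq> EG_step P (range \<pi>)"
    using \<pi> by (auto simp: EG_step_def infinite_path_def)
  then have "range \<pi> \<subseteq> gfp (EG_step P)" by (rule gfp_upperbound)
  then show "s \<in> gfp (EG_step P)" using \<pi>(2) by blast
qed

section \<open>Unravelling a state into a tree\<close>

definition successors :: "'s \<Rightarrow> 's list" where
  "successors s = (SOME xs. set xs = Next M s \<and> distinct xs)"

lemma set_successors [simp]: "set (successors s) = Next M s"
  and distinct_successors [simp]: "distinct (successors s)"
  using someI_ex[OF finite_distinct_list[OF finite_Next]] by (auto simp: successors_def)

lemma successors_nonempty: "s \<in> states M \<Longrightarrow> successors s \<noteq> []"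
  by (metis Next_nonempty set_successors set_empty)

text \<open>Every branch is cut at its first \<open>P\<close>-state and may otherwise run forever.
  Thus one construction provides the witnesses for both \<open>AF\<close> and
  \<open>AR\<close>.\<close>

primcorec unfold_tree :: "('s \<Rightarrow> bool) \<Rightarrow> 's \<Rightarrow> 's tree" where
  "label (unfold_tree P s) = s"
| "children (unfold_tree P s) = map (unfold_tree P) (if P s then [] else successors s)"

text \<open>An invariant principle: \<open>X\<close> has to be closed under successors only at
  states where the unravelling continues. It is used with \<open>X\<close> the whole type, the set
  of states, and the greatest fixpoint for \<open>AR\<close>.\<close>

lemma nodes_unfold_tree:
  assumes "u \<in> nodes (unfold_tree P s)" and "s \<in> X"
    and closed: "\<And>x. x \<in> X \<Longrightarrow> \<not> P x \<Longrightarrow> Next M x \<subseteq> X"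
  shows "\<exists>x\<in>X. u = unfold_tree P x"
  using assms(1)
proof induction
  case root
  then show ?case using assms(2) by blast
next
  case (child u v)
  then obtain x where x: "x \<in> X" "u = unfold_tree P x" by blast
  with child.hyps(2) obtain x' where "\<not> P x" "x' \<in> Next M x" "v = unfold_tree P x'"
    by (auto split: if_splits)
  then show ?case using closed x(1) by blast
qed

lemma Next_tree_unfold_tree: "Next_tree M (unfold_tree P s)"
  unfolding Next_tree_def
proof (intro ballI)
  fix u
  assume "u \<in> nodes (unfold_tree P s)"
  then obtain x where "u = unfold_tree P x"
    using nodes_unfold_tree[of u P s UNIV] by blast
  then show "children u \<noteq> [] \<longrightarrow> distinct (map label (children u)) \<and>
      set (map label (children u)) = Next M (label u)"
    by (simp add: comp_def image_image)
qed

text \<open>Totality of the transition relation rules out leaves caused by a lack of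
  successors.\<close>

lemma leaf_unfold_tree:
  "x \<in> states M \<Longrightarrow> children (unfold_tree P x) = [] \<Longrightarrow> P x"
  using successors_nonempty by (auto split: if_splits)

text \<open>The rules for \<open>nodes\<close> extend a branch at its lower end; here it is extended
  at the root.\<close>

lemma nodes_child: "v \<in> nodes u \<Longrightarrow> u \<in> set (children t) \<Longrightarrow> v \<in> nodes t"
  by (induction rule: nodes.induct) (auto intro: nodes.intros)

lemma Next_tree_child: "Next_tree M t \<Longrightarrow> u \<in> set (children t) \<Longrightarrow> Next_tree M u"
  by (auto simp: Next_tree_def dest: nodes_child)

lemma label_children:
  assumes "Next_tree M t" and "u \<in> nodes t" and "children u \<noteq> []"
  shows "label ` set (children u) = Next M (label u)"
  using assms by (auto simp: Next_tree_def)

text \<open>The unravelling of a state in \<open>AF_states P\<close> is finite by induction on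
  membership. Conversely, induction on a finite tree follows the two clauses of
  \<open>AF_states\<close>: a leaf is \<open>base\<close>, an internal node is
  \<open>step\<close>.\<close>

lemma AF_states_iff_tree:
  assumes "s \<in> states M"
  shows "s \<in> AF_states P \<longleftrightarrow>
    (\<exists>t. finite_tree t \<and> Next_tree M t \<and> label t = s \<and>
      (\<forall>u\<in>nodes t. children u = [] \<longrightarrow> P (label u)))"
proof
  assume "s \<in> AF_states P"
  then have "finite_tree (unfold_tree P s)"
  proof induction
    case (base s)
    then show ?case by (intro finite_tree.intros) simp
  next
    case (step s)
    then show ?case by (intro finite_tree.intros) simp
  qed
  moreover have "P (label u)" if u: "u \<in> nodes (unfold_tree P s)" "children u = []" for u
  proof -
    obtain x where "x \<in> states M" "u = unfold_tree P x"
      using nodes_unfold_tree[OF u(1) assms] Next_in_states by blast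
    then show ?thesis using leaf_unfold_tree u(2) by simp
  qed
  ultimately show "\<exists>t. finite_tree t \<and> Next_tree M t \<and> label t = s \<and>
      (\<forall>u\<in>nodes t. children u = [] \<longrightarrow> P (label u))"
    using Next_tree_unfold_tree by (intro exI[of _ "unfold_tree P s"]) auto
next
  assume "\<exists>t. finite_tree t \<and> Next_tree M t \<and> label t = s \<and>
      (\<forall>u\<in>nodes t. children u = [] \<longrightarrow> P (label u))"
  then obtain t where "finite_tree t" "Next_tree M t" "label t = s"
    "\<forall>u\<in>nodes t. children u = [] \<longrightarrow> P (label u)" by blast
  then show "s \<in> AF_states P"
    using assms
  proof (induction arbitrary: s)
    case (1 t)
    show ?case
    proof (cases "children t = []")
      case True
      then show ?thesis using 1 by (auto intro: AF_states.base nodes.root)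
    next
      case False
      then have lab: "label ` set (children t) = Next M s"
        using label_children[OF 1(2) nodes.root] 1(3) by simp
      have "s' \<in> AF_states P" if s': "s' \<in> Next M s" for s'
      proof -
        obtain u where u: "u \<in> set (children t)" and "label u = s'"
          using s' unfolding lab[symmetric] by blast
        moreover have "\<forall>v\<in>nodes u. children v = [] \<longrightarrow> P (label v)"
          using 1(4) nodes_child[OF _ u] by blast
        ultimately show ?thesis
          using 1(1) Next_tree_child[OF 1(2) u] Next_in_states[OF s'] by blast
      qed
      then show ?thesis using 1(5) by (auto intro: AF_states.step)
    qed
  qed
qed

text \<open>The unravelling of a state in the fixpoint never leaves the fixpoint, so
  \<open>Q\<close> holds at all its nodes. Conversely, the labels of a suitable tree form a
  post-fixpoint of \<open>AR_step P Q\<close>.\<close>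

lemma AR_gfp_iff_tree:
  assumes "s \<in> states M"
  shows "s \<in> gfp (AR_step P Q) \<longleftrightarrow>
    (\<exists>t. Next_tree M t \<and> label t = s \<and> (\<forall>u\<in>nodes t. Q (label u)) \<and>
      (\<forall>u\<in>nodes t. children u = [] \<longrightarrow> P (label u)))"
proof
  assume s: "s \<in> gfp (AR_step P Q)"
  let ?X = "gfp (AR_step P Q)"
  have "x \<in> AR_step P Q ?X" if "x \<in> ?X" for x
    using that gfp_unfold[OF mono_AR_step] by blast
  then have unfold: "x \<in> states M \<and> Q x \<and> (P x \<or> Next M x \<subseteq> ?X)" if "x \<in> ?X" for x
    using that by (auto simp: AR_step_def)
  have "Q (label u) \<and> (children u = [] \<longrightarrow> P (label u))" if u: "u \<in> nodes (unfold_tree P s)" for u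
  proof -
    obtain x where x: "x \<in> ?X" "u = unfold_tree P x"
      using nodes_unfold_tree[OF u s] unfold by blast
    then show ?thesis using unfold[OF x(1)] leaf_unfold_tree[of x P] by (metis unfold_tree.sel(1))
  qed
  then show "\<exists>t. Next_tree M t \<and> label t = s \<and> (\<forall>u\<in>nodes t. Q (label u)) \<and>
      (\<forall>u\<in>nodes t. children u = [] \<longrightarrow> P (label u))"
    using Next_tree_unfold_tree by (intro exI[of _ "unfold_tree P s"]) auto
next
  assume "\<exists>t. Next_tree M t \<and> label t = s \<and> (\<forall>u\<in>nodes t. Q (label u)) \<and>
      (\<forall>u\<in>nodes t. children u = [] \<longrightarrow> P (label u))"
  then obtain t where t: "Next_tree M t" "label t = s" "\<forall>u\<in>nodes t. Q (label u)"
    "\<forall>u\<in>nodes t. children u = [] \<longrightarrow> P (label u)" by blast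
  have "label u \<in> states M" if "u \<in> nodes t" for u
    using that
  proof induction
    case root
    then show ?case using t(2) assms by simp
  next
    case (child u v)
    then have "label v \<in> Next M (label u)" using label_children[OF t(1)] by fastforce
    then show ?case by (rule Next_in_states)
  qed
  moreover have "Next M (label u) \<subseteq> label ` nodes t" if "u \<in> nodes t" "children u \<noteq> []" for u
    using label_children[OF t(1) that] that by (auto intro: nodes.child)
  \<comment> \<open>A leaf satisfies the disjunct \<open>P\<close> of \<open>AR_step\<close>, an
    internal node the disjunct on successors.\<close>
  ultimately have "label ` nodes t \<subseteq> AR_step P Q (label ` nodes t)"
    using t by (fastforce simp: AR_step_def)
  then have "label ` nodes t \<subseteq> gfp (AR_step P Q)" by (rule gfp_upperbound)
  then show "s \<in> gfp (AR_step P Q)" using t(2) nodes.root by blast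
qed

section \<open>Soundness and completeness\<close>

lemma fm_over_subst: "s \<in> states M \<Longrightarrow> fm_over M \<phi> \<Longrightarrow> fm_over M (subst s x \<phi>)"
proof -
  assume s: "s \<in> states M"
  have "trm_over M t \<Longrightarrow> trm_over M (subst_trm s x t)" for t
    using s by (cases t) auto
  then show "fm_over M \<phi> \<Longrightarrow> fm_over M (subst s x \<phi>)"
    by (induction \<phi>) auto
qed

text \<open>The induction is on \<open>height\<close>, since the rules and the validity clauses pass
  to instances \<open>subst s x \<psi>\<close>, which need not be subformulas but have the height of
  \<open>\<psi>\<close>. For a modality applied to a variable both sides are false.\<close>

lemma derivable_iff_valid: "fm_over M \<phi> \<Longrightarrow> (SCTL(M) : {||} \<turnstile> \<phi>) \<longleftrightarrow> M \<Turnstile> \<phi>"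
proof (induction "height \<phi>" arbitrary: \<phi> rule: less_induct)
  case less
  have sub: "(SCTL(M) : {||} \<turnstile> subst s x \<psi>) \<longleftrightarrow> M \<Turnstile> subst s x \<psi>"
    if "height \<psi> < height \<phi>" "fm_over M \<psi>" "s \<in> states M" for s x \<psi>
    using less.hyps that by (simp add: fm_over_subst)
  show ?case
  proof (cases \<phi>)
    case Top
    then show ?thesis by (auto intro: top_R)
  next
    case Bot
    then show ?thesis by (auto elim: sctl_BotE)
  next
    case (Atom p ts)
    then show ?thesis by (auto intro: atom_R elim: sctl_AtomE)
  next
    case (NegAtom p ts)
    then show ?thesis by (auto intro: neg_R elim: sctl_NegAtomE)
  next
    case (Conj \<psi> \<chi>)
    have "(SCTL(M) : {||} \<turnstile> Conj \<psi> \<chi>) \<longleftrightarrow> (SCTL(M) : {||} \<turnstile> \<psi>) \<and> (SCTL(M) : {||} \<turnstile> \<chi>)"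
      by (auto intro: conj_R elim: sctl_ConjE)
    then show ?thesis using less Conj by (simp add: less_Suc_eq_le)
  next
    case (Disj \<psi> \<chi>)
    have "(SCTL(M) : {||} \<turnstile> Disj \<psi> \<chi>) \<longleftrightarrow> (SCTL(M) : {||} \<turnstile> \<psi>) \<or> (SCTL(M) : {||} \<turnstile> \<chi>)"
      by (auto intro: disj_R1 disj_R2 elim: sctl_DisjE)
    then show ?thesis using less Disj by (simp add: less_Suc_eq_le)
  next
    case (AX_of x \<psi> t)
    show ?thesis
    proof (cases t)
      case (Const s)
      have "(SCTL(M) : {||} \<turnstile> AX_of x \<psi> (Const s)) \<longleftrightarrow>
          (\<forall>s'\<in>Next M s. SCTL(M) : {||} \<turnstile> subst s' x \<psi>)"
        by (auto intro: AX_R elim: sctl_AXE)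
      then show ?thesis using less.prems AX_of Const sub by (auto simp: Next_in_states)
    qed (auto simp: AX_of elim: sctl_AXE)
  next
    case (EX_of x \<psi> t)
    show ?thesis
    proof (cases t)
      case (Const s)
      have "(SCTL(M) : {||} \<turnstile> EX_of x \<psi> (Const s)) \<longleftrightarrow>
          (\<exists>s'\<in>Next M s. SCTL(M) : {||} \<turnstile> subst s' x \<psi>)"
        by (auto intro: EX_R elim: sctl_EXE)
      then show ?thesis using less.prems EX_of Const sub by (auto simp: Next_in_states)
    qed (auto simp: EX_of elim: sctl_EXE)
  next
    case (AF_of x \<psi> t)
    show ?thesis
    proof (cases t)
      case (Const s)
      then have s: "s \<in> states M" using less.prems AF_of by simp
      \<comment> \<open>By \<open>sub\<close>, derivability and validity of instances agree on
        states, so validity can be taken as the predicate \<open>P\<close>. The tree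
        characterization of \<open>AF_states\<close> is then exactly the validity clause; the three
        cases below follow the same pattern.\<close>
      have "(SCTL(M) : {||} \<turnstile> AF_of x \<psi> (Const s)) \<longleftrightarrow> s \<in> AF_states (\<lambda>s. M \<Turnstile> subst s x \<psi>)"
        using less.prems AF_of sub s by (intro derivable_AF_iff) auto
      then show ?thesis unfolding AF_of Const AF_states_iff_tree[OF s] by simp
    qed (auto simp: AF_of elim: sctl_AF_VarE)
  next
    case (EG_of x \<psi> t)
    show ?thesis
    proof (cases t)
      case (Const s)
      then have s: "s \<in> states M" using less.prems EG_of by simp
      have "(SCTL(M) : {||} \<turnstile> EG_of x \<psi> (Const s)) \<longleftrightarrow> s \<in> gfp (EG_step (\<lambda>s. M \<Turnstile> subst s x \<psi>))"
        using less.prems EG_of sub s by (intro derivable_EG_iff) auto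
      then show ?thesis unfolding EG_of Const EG_gfp_iff_path[OF s] by simp
    qed (auto simp: EG_of elim: sctl_EG_VarE)
  next
    case (AR_of x y \<psi> \<chi> t)
    show ?thesis
    proof (cases t)
      case (Const s)
      then have s: "s \<in> states M" using less.prems AR_of by simp
      have "(SCTL(M) : {||} \<turnstile> AR_of x y \<psi> \<chi> (Const s)) \<longleftrightarrow>
          s \<in> gfp (AR_step (\<lambda>s. M \<Turnstile> subst s x \<psi>) (\<lambda>s. M \<Turnstile> subst s y \<chi>))"
        using less.prems AR_of sub s by (intro derivable_AR_iff) auto
      then show ?thesis unfolding AR_of Const AR_gfp_iff_tree[OF s] by simp
    qed (auto simp: AR_of elim: sctl_AR_VarE)
  next
    case (EU_of x y \<psi> \<chi> t)
    show ?thesis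
    proof (cases t)
      case (Const s)
      then have s: "s \<in> states M" using less.prems EU_of by simp
      have "(SCTL(M) : {||} \<turnstile> EU_of x y \<psi> \<chi> (Const s)) \<longleftrightarrow>
          s \<in> EU_states (\<lambda>s. M \<Turnstile> subst s x \<psi>) (\<lambda>s. M \<Turnstile> subst s y \<chi>)"
        using less.prems EU_of sub s by (intro derivable_EU_iff) auto
      then show ?thesis unfolding EU_of Const EU_states_iff_path[OF s] by simp
    qed (auto simp: EU_of elim: sctl_EU_VarE)
  qed
qed

end

theorem theorem1:
  fixes M :: "('s, 'p) kripke" and \<phi> :: "('s, 'p) fm"
  assumes "kripke_model M"
    and "fm_over M \<phi>"
    and "closed_fm \<phi>"
  shows "(SCTL(M) : {||} \<turnstile> \<phi>) \<longleftrightarrow> M \<Turnstile> \<phi>"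
  using kripke_model.derivable_iff_valid[OF assms(1,2)] .

end
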